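(* Let $\alpha^+,\lambda^+,\alpha^-,\lambda^-\in(0,\infty)$ and $\beta^+,\beta^-\in[0,1)$. Then we have the weak convergence $$\mathrm{TS}(n^{1-\beta^+}\alpha^+,\beta^+,n\lambda^+;n^{1-\beta^-}\alpha^-,\beta^-,n\lambda^-)\overset{w}{\to}\delta_\mu\quad\text{for }n\to\infty,$$ where $$\mu=\Gamma(1-\beta^+)\frac{\alpha^+}{(\lambda^+)^{1-\beta^+}}-\Gamma(1-\beta^-)\frac{\alpha^-}{(\lambda^-)^{1-\beta^-}}.$$
   Context: For $\alpha^+,\lambda^+,\alpha^-,\lambda^-\in(0,\infty)$ and $\beta^+,\beta^-\in[0,1)$, the tempered stable distribution $\mathrm{TS}(\alpha^+,\beta^+,\lambda^+;\alpha^-,\beta^-,\lambda^-)$ is the infinitely divisible distribution on $\mathbb{R}$ with characteristic function $\varphi(z)=\exp\big(\int_{\mathbb{R}}(e^{izx}-1)F(dx)\big)$, $z\in\mathbb{R}$, where $$F(dx)=\Big(\frac{\alpha^+}{x^{1+\beta^+}}e^{-\lambda^+x}\mathbf{1}_{(0,\infty)}(x)+\frac{\alpha^-}{|x|^{1+\beta^-}}e^{-\lambda^-|x|}\mathbf{1}_{(-\infty,0)}(x)\Big)dx.$$ $\delta_\mu$ is the Dirac measure at $\mu$ and $\Gamma$ is the Gamma function. The number $\mu$ is the mean of $\mathrm{TS}(\alpha^+,\beta^+,\lambda^+;\alpha^-,\beta^-,\lambda^-)$. *)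

theory Defs
  imports "HOL-Probability.Probability"
begin

definition conv_power :: "nat \<Rightarrow> real measure \<Rightarrow> real measure" where
  "conv_power k N = ((\<lambda>K. convolution K N) ^^ k) (return borel 0)"

definition infinitely_divisible :: "real measure \<Rightarrow> bool" where
  "infinitely_divisible M \<longleftrightarrow>
     real_distribution M \<and>
     (\<forall>k\<ge>1. \<exists>N. real_distribution N \<and> M = conv_power k N)"

text \<open>Parameters come in the order \<open>\<alpha>\<^sup>+, \<beta>\<^sup>+, \<lambda>\<^sup>+, \<alpha>\<^sup>-, \<beta>\<^sup>-, \<lambda>\<^sup>-\<close>, here \<open>a b l a' b' l'\<close>.\<close>

definition ts_levy_measure ::
  "real \<Rightarrow> real \<Rightarrow> real \<Rightarrow> real \<Rightarrow> real \<Rightarrow> real \<Rightarrow> real measure" where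
  "ts_levy_measure a b l a' b' l' =
     density lborel (\<lambda>x. ennreal
       (a / x powr (1 + b) * exp (- l * x) * indicator {0<..} x +
        a' / \<bar>x\<bar> powr (1 + b') * exp (- l' * \<bar>x\<bar>) * indicator {..<0} x))"

text \<open>By \<open>Levy_uniqueness\<close> at most one measure satisfies the description below. Such a
  measure exists whenever \<open>a, l, a', l' > 0\<close> and \<open>0 \<le> b, b' < 1\<close>; for other
  parameters the value carries no meaning.\<close>

definition tempered_stable ::
  "real \<Rightarrow> real \<Rightarrow> real \<Rightarrow> real \<Rightarrow> real \<Rightarrow> real \<Rightarrow> real measure" where
  "tempered_stable a b l a' b' l' =
     (THE M. infinitely_divisible M \<and>
        (\<forall>z. char M z =
           exp (CLINT x | ts_levy_measure a b l a' b' l'. (iexp (z * x) - 1))))"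

end

theory Submission
  imports Defs
begin

text \<open>
  A nonnegative density \<open>f\<close> with \<open>\<bar>x\<bar> f(x)\<close> integrable is the Levy density of an infinitely
  divisible law. For each \<open>m\<close> take the distribution that puts mass \<open>f(x) dx / m\<close> on the jumps
  \<open>\<bar>x\<bar> > C / m\<close> and the remaining mass at \<open>0\<close>; its \<open>m\<close>-fold convolution power has characteristic
  function \<open>(1 + \<psi>\<^sub>m / m)\<^sup>m\<close> with \<open>\<psi>\<^sub>m \<rightarrow> \<psi>(z) = \<integral> (exp (i z x) - 1) f(x) dx\<close>. The first absolute
  moments of these powers are bounded by \<open>C\<close>, so they are tight and a weak limit has characteristic
  function \<open>exp \<psi>\<close>. Infinite divisibility follows by applying this to \<open>f / k\<close>.

  With \<open>f\<close> the tempered stable density, the rescaled parameters give the density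
  \<open>n\<^sup>2 f(n x)\<close>, hence the exponent \<open>\<integral> n (exp (i z x / n) - 1) f(x) dx\<close>, which tends to
  \<open>i z \<integral> x f(x) dx = i z \<mu>\<close> by dominated convergence.
\<close>

section \<open>Elementary limits of complex exponentials\<close>

lemma cmod_iexp_minus_one_le: "cmod (iexp x - 1) \<le> \<bar>x\<bar>"
  using iexp_approx1[of x 0] by simp

text \<open>In the closed unit disc, k-th powers differ by at most k times the difference of their
  bases. The bases here are 1 + u n / k and exp (v / k) with k = n + 1; by Taylor they differ by at
  most |u n - v| / k plus a term of order 1 / k^2.\<close>

lemma complex_exp_limit_sequentially:
  fixes u :: "nat \<Rightarrow> complex"
  assumes u: "u \<longlonglongrightarrow> v"
    and le: "\<And>n. norm (1 + u n / of_nat (Suc n)) \<le> 1"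
  shows "(\<lambda>n. (1 + u n / of_nat (Suc n)) ^ Suc n) \<longlonglongrightarrow> exp v"
proof -
  \<comment> \<open>A real part never exceeds the norm. In the limit Re v \<le> 0, which puts exp (v
    / k) into the unit disc as well.\<close>
  have "Re (u n) \<le> 0" for n
  proof -
    have "1 + Re (u n) / real (Suc n) = Re (1 + u n / of_nat (Suc n))"
      by (metis Re_divide_of_nat one_complex.sel(1) plus_complex.sel(1))
    also have "\<dots> \<le> 1"
      using le[of n] complex_Re_le_cmod order_trans by blast
    finally show ?thesis by (simp add: divide_le_0_iff)
  qed
  then have "Re v \<le> 0"
    by (intro LIMSEQ_le_const2[OF tendsto_Re[OF u]]) auto
  have bound: "norm ((1 + u n / of_nat (Suc n)) ^ Suc n - exp v)
      \<le> norm (u n - v) + exp \<bar>Re v\<bar> * (norm v)\<^sup>2 / real (Suc n)" for n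
  proof -
    define k where "k = real (Suc n)"
    have k: "k \<ge> 1" "of_nat (Suc n) = complex_of_real k"
      by (simp_all add: k_def)
    define w where "w = v / complex_of_real k"
    have w: "exp w ^ Suc n = exp v"
      unfolding exp_of_nat_mult[symmetric] w_def k(2) using k(1) by simp
    have "Re w \<le> 0"
      using \<open>Re v \<le> 0\<close> k by (simp add: w_def divide_le_0_iff)
    then have nw: "norm (exp w) \<le> 1" by simp
    have "norm (exp w - (1 + w)) \<le> exp \<bar>Re w\<bar> * (norm w)\<^sup>2"
      using Taylor_exp[of w 1] by (simp add: power2_eq_square)
    \<comment> \<open>As k \<ge> 1, |Re w| is at most |Re v|, so the Taylor constant does not depend
      on n.\<close>
    also have "\<dots> \<le> exp \<bar>Re v\<bar> * (norm w)\<^sup>2"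
      using k by (intro mult_right_mono) (auto simp: w_def abs_divide divide_le_eq mult_le_cancel_left1)
    also have "(norm w)\<^sup>2 = (norm v)\<^sup>2 / k\<^sup>2"
      using k by (simp add: w_def norm_divide power_divide)
    finally have T: "norm (exp w - (1 + w)) \<le> exp \<bar>Re v\<bar> * ((norm v)\<^sup>2 / k\<^sup>2)" .
    have "norm ((1 + u n / of_nat (Suc n)) ^ Suc n - exp v)
        \<le> k * norm ((1 + u n / of_nat (Suc n)) - exp w)"
      using norm_power_diff[OF le nw, of n "Suc n"] by (simp only: w k_def)
    also have "\<dots> \<le> k * (norm ((u n - v) / complex_of_real k) + norm (exp w - (1 + w)))"
    proof (rule mult_left_mono)
      have eq: "1 + u n / of_nat (Suc n) - exp w = (u n - v) / complex_of_real k - (exp w - (1 + w))"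
        unfolding k(2) by (simp add: w_def diff_divide_distrib)
      show "norm (1 + u n / of_nat (Suc n) - exp w)
          \<le> norm ((u n - v) / complex_of_real k) + norm (exp w - (1 + w))"
        unfolding eq by (rule norm_triangle_ineq4)
    qed (use k in simp)
    also have "\<dots> = norm (u n - v) + k * norm (exp w - (1 + w))"
      using k by (simp add: norm_divide distrib_left)
    also have "\<dots> \<le> norm (u n - v) + k * (exp \<bar>Re v\<bar> * ((norm v)\<^sup>2 / k\<^sup>2))"
      using mult_left_mono[OF T, of k] k by linarith
    also have "\<dots> = norm (u n - v) + exp \<bar>Re v\<bar> * (norm v)\<^sup>2 / real (Suc n)"
      unfolding k_def[symmetric] using k by (simp add: power2_eq_square)
    finally show ?thesis .
  qed
  have "(\<lambda>n. norm (u n - v) + exp \<bar>Re v\<bar> * (norm v)\<^sup>2 / real (Suc n)) \<longlonglongrightarrow> 0 + 0"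
    using u by (intro tendsto_add tendsto_norm_zero LIM_zero lim_const_over_n[THEN LIMSEQ_Suc]) auto
  then show ?thesis
    by (intro LIM_zero_cancel[OF Lim_null_comparison[OF eventuallyI[OF bound]]]) simp
qed

section \<open>Convolution powers, their first moments, and tightness\<close>

lemma real_distribution_convolution:
  assumes "real_distribution M" "real_distribution N"
  shows "real_distribution (M \<star> N)"
proof -
  interpret M: real_distribution M by fact
  interpret N: real_distribution N by fact
  interpret P: pair_prob_space M N ..
  show ?thesis
    unfolding convolution_def by (intro P.P.real_distribution_distr) measurable
qed

lemma char_convolution:
  assumes "real_distribution M" "real_distribution N"
  shows "char (M \<star> N) t = char M t * char N t"
proof -
  interpret M: real_distribution M by fact
  interpret N: real_distribution N by fact
  interpret P: pair_prob_space M N ..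
  have meas [measurable]: "(\<lambda>p. iexp (t * (fst p + snd p))) \<in> borel_measurable (M \<Otimes>\<^sub>M N)"
    by measurable
  have "char (M \<star> N) t = (CLINT p|M \<Otimes>\<^sub>M N. iexp (t * (fst p + snd p)))"
    by (simp add: char_def convolution_def integral_distr split_def del: of_real_mult of_real_add)
  also have "\<dots> = (CLINT x|M. CLINT y|N. iexp (t * (x + y)))"
    by (subst P.integral_fst'[symmetric])
       (auto intro!: P.P.integrable_const_bound[where B=1])
  also have "\<dots> = (CLINT x|M. CLINT y|N. iexp (t * x) * iexp (t * y))"
    by (simp add: exp_add distrib_left)
  also have "\<dots> = char M t * char N t"
    by (simp add: char_def)
  finally show ?thesis .
qed

lemma nn_integral_abs_convolution_le:
  assumes "real_distribution M" "real_distribution N"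
  shows "(\<integral>\<^sup>+x. ennreal \<bar>x\<bar> \<partial>(M \<star> N)) \<le> (\<integral>\<^sup>+x. ennreal \<bar>x\<bar> \<partial>M) + (\<integral>\<^sup>+x. ennreal \<bar>x\<bar> \<partial>N)"
proof -
  interpret M: real_distribution M by fact
  interpret N: real_distribution N by fact
  have "(\<integral>\<^sup>+x. ennreal \<bar>x\<bar> \<partial>(M \<star> N)) = (\<integral>\<^sup>+x. \<integral>\<^sup>+y. ennreal \<bar>x + y\<bar> \<partial>N \<partial>M)"
    by (rule nn_integral_convolution) (auto intro: M.finite_measure_axioms N.finite_measure_axioms)
  also have "\<dots> \<le> (\<integral>\<^sup>+x. \<integral>\<^sup>+y. ennreal \<bar>x\<bar> + ennreal \<bar>y\<bar> \<partial>N \<partial>M)"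
    by (intro nn_integral_mono) (simp flip: ennreal_plus)
  also have "\<dots> = (\<integral>\<^sup>+x. ennreal \<bar>x\<bar> \<partial>M) + (\<integral>\<^sup>+x. ennreal \<bar>x\<bar> \<partial>N)"
    by (simp add: nn_integral_add M.emeasure_space_1[simplified] N.emeasure_space_1[simplified])
  finally show ?thesis .
qed

lemma conv_power_simps:
  "conv_power 0 N = return borel 0"
  "conv_power (Suc k) N = (conv_power k N \<star> N)"
  by (simp_all add: conv_power_def)

lemma real_distribution_return: "real_distribution (return borel (x::real))"
  unfolding real_distribution_def real_distribution_axioms_def
  by (simp add: prob_space_return)

lemma real_distribution_conv_power:
  "real_distribution N \<Longrightarrow> real_distribution (conv_power k N)"
  by (induction k)
     (simp_all add: conv_power_simps real_distribution_return real_distribution_convolution)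

lemma char_return: "char (return borel m) t = iexp (t * m)"
  by (simp add: char_def integral_return)

lemma char_conv_power:
  "real_distribution N \<Longrightarrow> char (conv_power k N) t = char N t ^ k"
  by (induction k)
     (simp_all add: conv_power_simps char_return char_convolution real_distribution_conv_power
        mult.commute)

text \<open>The absolute first moment is subadditive under convolution. If the factor has moment at
  most C / k, its k-th power has moment at most C, a bound free of k as tightness requires.\<close>

lemma nn_integral_abs_conv_power_le:
  assumes "real_distribution N"
  shows "(\<integral>\<^sup>+x. ennreal \<bar>x\<bar> \<partial>conv_power k N) \<le> of_nat k * (\<integral>\<^sup>+x. ennreal \<bar>x\<bar> \<partial>N)"
proof (induction k)
  case 0
  then show ?case by (simp add: conv_power_simps nn_integral_return)
next
  case (Suc k)
  have "(\<integral>\<^sup>+x. ennreal \<bar>x\<bar> \<partial>conv_power (Suc k) N)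
      \<le> (\<integral>\<^sup>+x. ennreal \<bar>x\<bar> \<partial>conv_power k N) + (\<integral>\<^sup>+x. ennreal \<bar>x\<bar> \<partial>N)"
    unfolding conv_power_simps
    by (intro nn_integral_abs_convolution_le real_distribution_conv_power assms)
  also have "\<dots> \<le> of_nat k * (\<integral>\<^sup>+x. ennreal \<bar>x\<bar> \<partial>N) + (\<integral>\<^sup>+x. ennreal \<bar>x\<bar> \<partial>N)"
    by (intro add_right_mono Suc)
  finally show ?case by (simp add: distrib_right add.commute)
qed

text \<open>Markov's inequality bounds the mass outside (-K, K] by C / K, uniformly in n.\<close>

lemma tight_of_bounded_first_moment:
  assumes dist: "\<And>n. real_distribution (M n)"
    and le: "\<And>n. (\<integral>\<^sup>+x. ennreal \<bar>x\<bar> \<partial>M n) \<le> ennreal C" and C: "C \<ge> 0"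
  shows "tight M"
  unfolding tight_def
proof (intro conjI allI impI)
  fix e :: real assume e: "e > 0"
  \<comment> \<open>The summand 1 keeps K positive when C = 0 and makes C / K = e C / (C + 1)
    smaller than e.\<close>
  define K where "K = (C + 1) / e"
  have K: "K > 0" "C / K < e"
    using e C by (auto simp: K_def field_simps)
  have "measure (M n) {-K<..K} > 1 - e" for n
  proof -
    interpret M: real_distribution "M n" by (rule dist)
    have int: "integrable (M n) abs"
      using le[of n] by (intro integrableI_bounded) (auto intro: order_le_less_trans)
    have "(\<integral>x. \<bar>x\<bar> \<partial>M n) \<le> C"
      using le[of n] C int by (subst (asm) nn_integral_eq_integral) auto
    then have "measure (M n) {x\<in>space (M n). \<bar>x\<bar> \<ge> K} \<le> C / K"
      using integral_Markov_inequality_measure[OF int, of "{}" K] K(1)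
      by (auto elim!: order_trans intro!: divide_right_mono)
    moreover have "1 - measure (M n) {-K<..K} = measure (M n) (space (M n) - {-K<..K})"
      by (subst M.prob_compl) auto
    moreover have "\<dots> \<le> measure (M n) {x\<in>space (M n). \<bar>x\<bar> \<ge> K}"
      by (intro M.finite_measure_mono) auto
    ultimately show ?thesis using K(2) by linarith
  qed
  with K(1) show "\<exists>a b. a < b \<and> (\<forall>n. 1 - e < measure (M n) {a<..b})"
    by (intro exI[of _ "-K"] exI[of _ K]) auto
qed (rule dist)


section \<open>Infinitely divisible laws with a prescribed Levy density\<close>

lemma tail_mass_le:
  fixes f :: "real \<Rightarrow> real"
  assumes [measurable]: "f \<in> borel_measurable borel" and nonneg: "\<And>x. f x \<ge> 0"
    and int: "integrable lborel (\<lambda>x. \<bar>x\<bar> * f x)" and e: "e > 0"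
  shows "integrable lborel (\<lambda>x. if \<bar>x\<bar> > e then f x else 0)"
    and "(LINT x|lborel. (if \<bar>x\<bar> > e then f x else 0)) \<le> (LINT x|lborel. \<bar>x\<bar> * f x) / e"
proof -
  \<comment> \<open>Where |x| > e, the factor |x| / e exceeds 1.\<close>
  have le: "(if \<bar>x\<bar> > e then f x else 0) \<le> \<bar>x\<bar> * f x / e" for x
    using e nonneg[of x] by (auto simp: field_simps intro: mult_right_mono)
  have int': "integrable lborel (\<lambda>x. \<bar>x\<bar> * f x / e)"
    using int by simp
  show *: "integrable lborel (\<lambda>x. if \<bar>x\<bar> > e then f x else 0)"
    by (rule Bochner_Integration.integrable_bound[OF int'])
       (use le nonneg e in \<open>auto simp: abs_mult\<close>)
  show "(LINT x|lborel. (if \<bar>x\<bar> > e then f x else 0)) \<le> (LINT x|lborel. \<bar>x\<bar> * f x) / e"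
    using integral_mono[OF * int' le] by simp
qed

text \<open>The mixture \<open>(1 - c / k) \<delta>\<^sub>0 + f(x) 1(\<bar>x\<bar> > C / k) dx / k\<close>, where \<open>c\<close> is the mass of
  \<open>f\<close> outside \<open>[-C / k, C / k]\<close>, is realised as the image of a measure with a Lebesgue density
  under the map that collapses \<open>[-C / k, C / k]\<close> to \<open>0\<close>.\<close>

lemma ex_small_jump_mixture:
  fixes f :: "real \<Rightarrow> real"
  assumes f [measurable]: "f \<in> borel_measurable borel" and nonneg: "\<And>x. f x \<ge> 0"
    and int: "integrable lborel (\<lambda>x. \<bar>x\<bar> * f x)"
    and C: "C > 0" "(LINT x|lborel. \<bar>x\<bar> * f x) \<le> C" and k: "k > 0"
  shows "\<exists>H. real_distribution H \<and>
    (\<forall>z. char H z = 1 + (CLINT x|lborel. (if \<bar>x\<bar> > C / k then f x else 0) *\<^sub>R (iexp (z * x) - 1)) / k) \<and>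
    (\<integral>\<^sup>+x. ennreal \<bar>x\<bar> \<partial>H) \<le> ennreal (C / k)"
proof -
  define e where "e = C / k"
  have e: "e > 0" using C k by (simp add: e_def)
  define fe where "fe x = (if \<bar>x\<bar> > e then f x else 0)" for x
  have [measurable]: "fe \<in> borel_measurable borel"
    unfolding fe_def by measurable
  have fe_nonneg: "fe x \<ge> 0" for x
    using nonneg by (simp add: fe_def)
  define c where "c = (LINT x|lborel. fe x)"
  have int_fe: "integrable lborel fe"
    unfolding fe_def by (rule tail_mass_le[OF f nonneg int e])
  \<comment> \<open>The truncation level e = C / k is chosen for this bound: with c \<le> k, the
    remaining mass 1 - c / k is nonnegative.\<close>
  have "c \<le> (LINT x|lborel. \<bar>x\<bar> * f x) / e"
    unfolding c_def fe_def by (rule tail_mass_le[OF f nonneg int e])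
  also have "\<dots> \<le> C / e"
    using C e by (intro divide_right_mono) auto
  also have "\<dots> = k" using C k by (simp add: e_def)
  finally have c: "c \<le> k" .
  \<comment> \<open>The remaining mass is spread uniformly over [-e, e], of length 2 e; the map
    \<open>g\<close> below sends it to 0.\<close>
  define d where "d = (1 - c / k) / (2 * e)"
  have d: "d \<ge> 0" using c k e by (simp add: d_def)
  define h where "h x = fe x / k + d * indicator {-e..e} x" for x
  have h_nonneg: "h x \<ge> 0" for x
    using fe_nonneg d k by (simp add: h_def)
  have [measurable]: "h \<in> borel_measurable borel"
    unfolding h_def by measurable
  have "has_bochner_integral lborel h (c / k + d * (2 * e))"
    unfolding h_def c_def
  proof (intro has_bochner_integral_add has_bochner_integral_divide_zero has_bochner_integral_mult_right)
    show "has_bochner_integral lborel fe (integral\<^sup>L lborel fe)"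
      using int_fe by (rule has_bochner_integral_integrable)
    show "has_bochner_integral lborel (indicator {-e..e}) (2 * e)"
      using has_bochner_integral_real_indicator[of "{-e..e}" lborel] e by simp
  qed
  moreover have "c / k + d * (2 * e) = 1"
    using e by (simp add: d_def)
  ultimately have h: "has_bochner_integral lborel h 1" by simp
  have "emeasure (density lborel h) (space (density lborel h)) = (\<integral>\<^sup>+x. ennreal (h x) \<partial>lborel)"
    by (simp add: emeasure_density)
  also have "\<dots> = 1"
    using h h_nonneg by (subst nn_integral_eq_integral) (auto simp: has_bochner_integral_iff)
  finally interpret D: prob_space "density lborel h" by (rule prob_spaceI)
  define g where "g x = (if \<bar>x\<bar> > e then x else 0)" for x :: real
  have g [measurable]: "g \<in> borel_measurable borel"
    unfolding g_def by measurable
  define H where "H = distr (density lborel h) borel g"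
  have H: "real_distribution H"
    unfolding H_def by (rule D.real_distribution_distr) simp
  interpret H: real_distribution H by (rule H)
  have char: "char H z = 1 + (CLINT x|lborel. fe x *\<^sub>R (iexp (z * x) - 1)) / k" for z
  proof -
    have "char H z = (CLINT x|H. 1 + (iexp (z * x) - 1))"
      by (simp add: char_def)
    also have "\<dots> = 1 + (CLINT x|H. (iexp (z * x) - 1))"
      by (subst Bochner_Integration.integral_add)
         (auto intro!: H.integrable_iexp simp: H.prob_space[simplified])
    also have "(CLINT x|H. (iexp (z * x) - 1)) = (CLINT x|lborel. h x *\<^sub>R (iexp (z * g x) - 1))"
      unfolding H_def by (simp add: integral_distr integral_density h_nonneg)
    \<comment> \<open>On [-e, e], \<open>g x\<close> is 0 and \<open>iexp (z * g x) - 1\<close>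
      vanishes; elsewhere \<open>g x\<close> is x and \<open>h x\<close> is
      \<open>fe x / k\<close>.\<close>
    also have "\<dots> = (CLINT x|lborel. fe x *\<^sub>R (iexp (z * x) - 1) / k)"
      by (intro Bochner_Integration.integral_cong)
         (auto simp: h_def g_def fe_def scaleR_conv_of_real indicator_def)
    finally show ?thesis by simp
  qed
  have "(\<integral>\<^sup>+x. ennreal \<bar>x\<bar> \<partial>H) = (\<integral>\<^sup>+x. ennreal (h x) * ennreal \<bar>g x\<bar> \<partial>lborel)"
    unfolding H_def by (simp add: nn_integral_distr nn_integral_density)
  also have "\<dots> \<le> (\<integral>\<^sup>+x. ennreal (\<bar>x\<bar> * f x / k) \<partial>lborel)"
    using nonneg k by (intro nn_integral_mono)
      (auto simp: h_def g_def fe_def indicator_def mult_ac simp flip: ennreal_mult)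
  also have "\<dots> = ennreal ((LINT x|lborel. \<bar>x\<bar> * f x) / k)"
    using int nonneg k by (subst nn_integral_eq_integral) auto
  also have "\<dots> \<le> ennreal (C / k)"
    using C k by (intro ennreal_leI divide_right_mono) auto
  finally show ?thesis
    using H char by (auto simp: fe_def e_def)
qed

lemma char_exponent_integrable:
  fixes f :: "real \<Rightarrow> real"
  assumes [measurable]: "f \<in> borel_measurable borel"
    and int: "integrable lborel (\<lambda>x. \<bar>x\<bar> * f x)"
  shows "integrable lborel (\<lambda>x. f x *\<^sub>R (iexp (z * x) - 1))"
proof (rule Bochner_Integration.integrable_bound)
  show "integrable lborel (\<lambda>x. \<bar>z\<bar> * (\<bar>x\<bar> * f x))"
    using int by simp
  show "AE x in lborel. norm (f x *\<^sub>R (iexp (z * x) - 1)) \<le> norm (\<bar>z\<bar> * (\<bar>x\<bar> * f x))"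
  proof (rule AE_I2)
    fix x
    show "norm (f x *\<^sub>R (iexp (z * x) - 1)) \<le> norm (\<bar>z\<bar> * (\<bar>x\<bar> * f x))"
      using mult_left_mono[OF cmod_iexp_minus_one_le[of "z * x"], of "\<bar>f x\<bar>"]
      by (simp add: abs_mult mult_ac)
  qed
qed measurable

lemma ex_distribution_with_levy_density:
  fixes f :: "real \<Rightarrow> real"
  assumes f [measurable]: "f \<in> borel_measurable borel" and nonneg: "\<And>x. f x \<ge> 0"
    and int: "integrable lborel (\<lambda>x. \<bar>x\<bar> * f x)"
  shows "\<exists>M. real_distribution M \<and>
    (\<forall>z. char M z = exp (CLINT x|lborel. f x *\<^sub>R (iexp (z * x) - 1)))"
proof -
  \<comment> \<open>Adding 1 keeps C, and with it every truncation level, positive even if f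
    vanishes almost everywhere.\<close>
  define C where "C = (LINT x|lborel. \<bar>x\<bar> * f x) + 1"
  have "(LINT x|lborel. \<bar>x\<bar> * f x) \<ge> 0"
    using nonneg by simp
  then have C: "C > 0" "(LINT x|lborel. \<bar>x\<bar> * f x) \<le> C"
    by (simp_all add: C_def)
  define \<psi> where "\<psi> m z =
    (CLINT x|lborel. (if \<bar>x\<bar> > C / real (Suc m) then f x else 0) *\<^sub>R (iexp (z * x) - 1))" for m z
  have "\<exists>H. real_distribution H \<and> (\<forall>z. char H z = 1 + \<psi> m z / of_nat (Suc m)) \<and>
    (\<integral>\<^sup>+x. ennreal \<bar>x\<bar> \<partial>H) \<le> ennreal (C / real (Suc m))" for m
    using ex_small_jump_mixture[OF f nonneg int C, of "real (Suc m)"] unfolding \<psi>_def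
    by (simp del: of_nat_Suc)
  then obtain H where H: "\<And>m. real_distribution (H m)"
      "\<And>m z. char (H m) z = 1 + \<psi> m z / of_nat (Suc m)"
      "\<And>m. (\<integral>\<^sup>+x. ennreal \<bar>x\<bar> \<partial>H m) \<le> ennreal (C / real (Suc m))"
    by metis
  define P where "P m = conv_power (Suc m) (H m)" for m
  have dist: "real_distribution (P m)" for m
    unfolding P_def by (intro real_distribution_conv_power H)
  have lim: "(\<lambda>m. \<psi> m z) \<longlonglongrightarrow> (CLINT x|lborel. f x *\<^sub>R (iexp (z * x) - 1))" for z
    unfolding \<psi>_def
  proof (rule integral_dominated_convergence)
    show "integrable lborel (\<lambda>x. norm (f x *\<^sub>R (iexp (z * x) - 1)))"
      by (intro integrable_norm char_exponent_integrable f int)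
    show "AE x in lborel. (\<lambda>m. (if \<bar>x\<bar> > C / real (Suc m) then f x else 0) *\<^sub>R (iexp (z * x) - 1))
        \<longlonglongrightarrow> f x *\<^sub>R (iexp (z * x) - 1)"
    proof (rule AE_I2)
      fix x :: real
      show "(\<lambda>m. (if \<bar>x\<bar> > C / real (Suc m) then f x else 0) *\<^sub>R (iexp (z * x) - 1))
        \<longlonglongrightarrow> f x *\<^sub>R (iexp (z * x) - 1)"
      \<comment> \<open>At x = 0 the factor \<open>iexp 0 - 1\<close> is 0. Any other x eventually
        lies beyond the truncation level, so the sequence is eventually constant.\<close>
      proof (cases "x = 0")
        case False
        have "(\<lambda>m. C / real (Suc m)) \<longlonglongrightarrow> 0"
          by (intro lim_const_over_n[THEN LIMSEQ_Suc])
        then have "eventually (\<lambda>m. C / real (Suc m) < \<bar>x\<bar>) sequentially"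
          using False by (intro order_tendstoD) auto
        then show ?thesis
          by (intro tendsto_eventually) (erule eventually_mono, simp del: of_nat_Suc)
      qed simp
    qed
  qed auto
  have char_lim: "(\<lambda>m. char (P m) z) \<longlonglongrightarrow> exp (CLINT x|lborel. f x *\<^sub>R (iexp (z * x) - 1))" for z
    unfolding P_def char_conv_power[OF H(1)] H(2)
    \<comment> \<open>The bases are values of the characteristic functions of \<open>H m\<close>,
      hence of norm at most 1.\<close>
    by (intro complex_exp_limit_sequentially lim)
       (metis H(1,2) real_distribution.cmod_char_le_1)
  have "(\<integral>\<^sup>+x. ennreal \<bar>x\<bar> \<partial>P m) \<le> ennreal C" for m
  proof -
    have "(\<integral>\<^sup>+x. ennreal \<bar>x\<bar> \<partial>P m) \<le> of_nat (Suc m) * ennreal (C / real (Suc m))"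
      unfolding P_def
      by (intro order_trans[OF nn_integral_abs_conv_power_le[OF H(1)]] mult_left_mono H(3)) simp
    also have "\<dots> = ennreal C"
      using C by (simp add: ennreal_of_nat_eq_real_of_nat flip: ennreal_mult del: of_nat_Suc)
    finally show ?thesis .
  qed
  then have "tight P"
    using C by (intro tight_of_bounded_first_moment dist) auto
  from tight_imp_convergent_subsubsequence[OF this strict_mono_id]
  obtain r M where r: "strict_mono r" and M: "real_distribution M" "weak_conv_m (P \<circ> r) M"
    by (auto simp: comp_def)
  \<comment> \<open>Weak convergence identifies the limit along r as \<open>char M z\<close>, while
    the full sequence already converges to exp of the exponent.\<close>
  have "char M z = exp (CLINT x|lborel. f x *\<^sub>R (iexp (z * x) - 1))" for z
  proof (rule LIMSEQ_unique)
    show "(\<lambda>m. char ((P \<circ> r) m) z) \<longlonglongrightarrow> char M z"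
      by (rule levy_continuity1[OF _ M]) (simp add: dist)
    show "(\<lambda>m. char ((P \<circ> r) m) z) \<longlonglongrightarrow> exp (CLINT x|lborel. f x *\<^sub>R (iexp (z * x) - 1))"
      using LIMSEQ_subseq_LIMSEQ[OF char_lim r] by (simp add: comp_def)
  qed
  with M(1) show ?thesis by blast
qed

lemma ex_infinitely_divisible_with_levy_density:
  fixes f :: "real \<Rightarrow> real"
  assumes f [measurable]: "f \<in> borel_measurable borel" and nonneg: "\<And>x. f x \<ge> 0"
    and int: "integrable lborel (\<lambda>x. \<bar>x\<bar> * f x)"
  shows "\<exists>M. infinitely_divisible M \<and>
    (\<forall>z. char M z = exp (CLINT x|lborel. f x *\<^sub>R (iexp (z * x) - 1)))"
proof -
  obtain M where M: "real_distribution M"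
    "\<And>z. char M z = exp (CLINT x|lborel. f x *\<^sub>R (iexp (z * x) - 1))"
    using ex_distribution_with_levy_density[OF f nonneg int] by blast
  have "\<exists>N. real_distribution N \<and> M = conv_power k N" if "k \<ge> 1" for k
  proof -
    obtain N where N: "real_distribution N"
      "\<And>z. char N z = exp (CLINT x|lborel. (f x / real k) *\<^sub>R (iexp (z * x) - 1))"
      using ex_distribution_with_levy_density[of "\<lambda>x. f x / real k"] f nonneg int by auto
    \<comment> \<open>Dividing the density by k divides the exponent by k, and the k-th power undoes
      this.\<close>
    have "char (conv_power k N) z = char M z" for z
    proof -
      have "(CLINT x|lborel. (f x / real k) *\<^sub>R (iexp (z * x) - 1))
          = (CLINT x|lborel. f x *\<^sub>R (iexp (z * x) - 1) / of_nat k)"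
        by (intro Bochner_Integration.integral_cong) (auto simp: scaleR_conv_of_real)
      then show ?thesis
        using \<open>k \<ge> 1\<close>
        by (simp add: char_conv_power N M flip: exp_of_nat_mult)
    qed
    then have "M = conv_power k N"
      by (intro Levy_uniqueness M real_distribution_conv_power N ext) simp
    with N(1) show ?thesis by blast
  qed
  with M show ?thesis unfolding infinitely_divisible_def by blast
qed

section \<open>The tempered stable law: characteristic function, moments and rescaling\<close>

definition ts_density :: "real \<Rightarrow> real \<Rightarrow> real \<Rightarrow> real \<Rightarrow> real \<Rightarrow> real \<Rightarrow> real \<Rightarrow> real" where
  "ts_density a b l a' b' l' x =
     a / x powr (1 + b) * exp (- l * x) * indicator {0<..} x +
     a' / \<bar>x\<bar> powr (1 + b') * exp (- l' * \<bar>x\<bar>) * indicator {..<0} x"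

lemma borel_measurable_ts_density [measurable]:
  "ts_density a b l a' b' l' \<in> borel_measurable borel"
  unfolding ts_density_def by measurable

lemma ts_density_nonneg: "a \<ge> 0 \<Longrightarrow> a' \<ge> 0 \<Longrightarrow> ts_density a b l a' b' l' x \<ge> 0"
  by (simp add: ts_density_def)

text \<open>A law with the described characteristic function exists by the construction above and is
  unique by \<open>Levy_uniqueness\<close>, so \<open>THE\<close> selects it. Nonnegative
  coefficients and an integrability condition also cover the index n = 0 of the rescaled sequence,
  where the density is zero.\<close>

lemma tempered_stable_char:
  assumes "a \<ge> 0" "a' \<ge> 0"
    and int: "integrable lborel (\<lambda>x. \<bar>x\<bar> * ts_density a b l a' b' l' x)"
  shows "real_distribution (tempered_stable a b l a' b' l')"
    and "char (tempered_stable a b l a' b' l') z =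
      exp (CLINT x|lborel. ts_density a b l a' b' l' x *\<^sub>R (iexp (z * x) - 1))"
proof -
  let ?f = "ts_density a b l a' b' l'"
  let ?P = "\<lambda>M. infinitely_divisible M \<and>
    (\<forall>z. char M z = exp (CLINT x | ts_levy_measure a b l a' b' l'. (iexp (z * x) - 1)))"
  have F: "ts_levy_measure a b l a' b' l' = density lborel (\<lambda>x. ennreal (?f x))"
    by (simp add: ts_levy_measure_def ts_density_def)
  have eq: "(CLINT x | ts_levy_measure a b l a' b' l'. (iexp (z * x) - 1)) =
      (CLINT x|lborel. ?f x *\<^sub>R (iexp (z * x) - 1))" for z
    unfolding F by (rule integral_density) (auto simp: ts_density_nonneg assms(1,2))
  obtain M where M: "?P M"
    using ex_infinitely_divisible_with_levy_density[OF _ ts_density_nonneg[OF assms(1,2)] int]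
    unfolding eq by auto
  have "?P (tempered_stable a b l a' b' l')"
    unfolding tempered_stable_def
  proof (rule theI)
    show "N = M" if "?P N" for N
      using that M by (intro Levy_uniqueness ext) (auto simp: infinitely_divisible_def)
  qed (rule M)
  then show "real_distribution (tempered_stable a b l a' b' l')"
    and "char (tempered_stable a b l a' b' l') z = exp (CLINT x|lborel. ?f x *\<^sub>R (iexp (z * x) - 1))"
    unfolding eq by (auto simp: infinitely_divisible_def)
qed

text \<open>Substituting t = l x in Euler's integral of t^(-b) exp (-t) for Gamma (1 - b) yields the
  integral of x^(-b) exp (-l x), up to a power of l.\<close>

lemma has_bochner_integral_gamma_density:
  fixes a b l :: real
  assumes l: "l > 0" and b: "b < 1"
  shows "has_bochner_integral lborel
    (\<lambda>x. x * (a / x powr (1 + b) * exp (- l * x) * indicator {0<..} x))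
    (Gamma (1 - b) * (a / l powr (1 - b)))"
proof -
  let ?g = "\<lambda>t::real. indicator {0..} t * t powr (1 - b - 1) / exp t"
  have "has_bochner_integral lborel ?g (Gamma (1 - b))"
    using b Gamma_conv_nn_integral_real[of "1 - b"]
    by (intro has_bochner_integral_nn_integral) (auto intro: less_imp_le)
  then have "has_bochner_integral lborel (\<lambda>x. ?g (0 + l * x)) (Gamma (1 - b) /\<^sub>R \<bar>l\<bar>)"
    using l by (subst (asm) lborel_has_bochner_integral_real_affine_iff[of l _ _ 0]) auto
  \<comment> \<open>The factor \<open>l powr b\<close> cancels the l^(-b) that
    \<open>?g (l * x)\<close> carries for x > 0.\<close>
  then have "has_bochner_integral lborel (\<lambda>x. a * l powr b * ?g (0 + l * x))
      (a * l powr b * (Gamma (1 - b) /\<^sub>R \<bar>l\<bar>))"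
    by (rule has_bochner_integral_mult_right)
  also have "a * l powr b * (Gamma (1 - b) /\<^sub>R \<bar>l\<bar>) = Gamma (1 - b) * (a / l powr (1 - b))"
    using l by (simp add: powr_diff field_simps)
  also have "(\<lambda>x. a * l powr b * ?g (0 + l * x)) =
      (\<lambda>x. x * (a / x powr (1 + b) * exp (- l * x) * indicator {0<..} x))"
  proof
    \<comment> \<open>At x = 0 the indicator in \<open>?g\<close> is 1, but \<open>0 powr\<close>
      any exponent is 0, so both sides vanish there too.\<close>
    fix x
    show "a * l powr b * ?g (0 + l * x) = x * (a / x powr (1 + b) * exp (- l * x) * indicator {0<..} x)"
      using l by (cases "x > 0")
        (auto simp: powr_mult powr_add powr_minus exp_minus field_simps indicator_def zero_le_mult_iff)
  qed
  finally show ?thesis .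
qed

text \<open>The negative half is a reflected positive half. The difference of the two gamma
  integrals is the mean, and their sum is the absolute moment.\<close>

lemma ts_density_moments:
  assumes "l > 0" "l' > 0" "b < 1" "b' < 1"
  shows "integrable lborel (\<lambda>x. \<bar>x\<bar> * ts_density a b l a' b' l' x)"
    and "has_bochner_integral lborel (\<lambda>x. x * ts_density a b l a' b' l' x)
      (Gamma (1 - b) * (a / l powr (1 - b)) - Gamma (1 - b') * (a' / l' powr (1 - b')))"
proof -
  let ?p = "\<lambda>a b l x::real. x * (a / x powr (1 + b) * exp (- l * x) * indicator {0<..} x)"
  have p: "has_bochner_integral lborel (?p a b l) (Gamma (1 - b) * (a / l powr (1 - b)))"
    using assms by (intro has_bochner_integral_gamma_density)
  have "has_bochner_integral lborel (?p a' b' l') (Gamma (1 - b') * (a' / l' powr (1 - b')))"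
    using assms by (intro has_bochner_integral_gamma_density)
  then have n: "has_bochner_integral lborel (\<lambda>x. ?p a' b' l' (- x))
      (Gamma (1 - b') * (a' / l' powr (1 - b')))"
    by (subst (asm) lborel_has_bochner_integral_real_affine_iff[of "-1" _ _ 0]) auto
  have "(\<lambda>x. x * ts_density a b l a' b' l' x) = (\<lambda>x. ?p a b l x - ?p a' b' l' (- x))"
    by (auto simp: ts_density_def fun_eq_iff indicator_def)
  then show "has_bochner_integral lborel (\<lambda>x. x * ts_density a b l a' b' l' x)
      (Gamma (1 - b) * (a / l powr (1 - b)) - Gamma (1 - b') * (a' / l' powr (1 - b')))"
    using has_bochner_integral_diff[OF p n] by simp
  have "(\<lambda>x. \<bar>x\<bar> * ts_density a b l a' b' l' x) = (\<lambda>x. ?p a b l x + ?p a' b' l' (- x))"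
    by (auto simp: ts_density_def fun_eq_iff indicator_def)
  then show "integrable lborel (\<lambda>x. \<bar>x\<bar> * ts_density a b l a' b' l' x)"
    using has_bochner_integral_add[OF p n] by (simp add: has_bochner_integral_iff)
qed

text \<open>At \<open>n = 0\<close> both sides vanish, since \<open>0 powr (1 - b) = 0\<close>.\<close>

lemma ts_density_rescale:
  "ts_density (real n powr (1 - b) * a) b (real n * l) (real n powr (1 - b') * a') b' (real n * l') x =
    (real n)\<^sup>2 * ts_density a b l a' b' l' (real n * x)"
proof (cases "n = 0")
  case False
  \<comment> \<open>The denominator n^(1 + c) merges with |x|^(1 + c) into |n x|^(1 + c), leaving
    n^2 in front.\<close>
  have *: "real n powr (1 - c) = (real n)\<^sup>2 / real n powr (1 + c)" for c
  proof -
    have "real n powr (1 - c) * real n powr (1 + c) = (real n)\<^sup>2"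
      using False by (simp flip: powr_add)
    then show ?thesis using False by (simp add: field_simps)
  qed
  have "(- (x * real n)) powr c = (- x) powr c * real n powr c" if "x < 0" for c
    using that powr_mult[of "- x" "real n" c] by simp
  then show ?thesis
    using False unfolding ts_density_def *
    by (cases x "0::real" rule: linorder_cases)
       (auto simp: powr_mult abs_mult zero_less_mult_iff mult_less_0_iff mult_ac)
qed (simp add: ts_density_def)

text \<open>The substitution y = n x uses up one factor of n^2 and moves n out of the density, so
  that the integrals for different n share the fixed f.\<close>

lemma tempered_stable_rescale_char:
  assumes "a > 0" "l > 0" "a' > 0" "l' > 0" "b < 1" "b' < 1"
  defines "T \<equiv> \<lambda>n. tempered_stable (real n powr (1 - b) * a) b (real n * l)
    (real n powr (1 - b') * a') b' (real n * l')"
  shows "real_distribution (T n)"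
    and "char (T n) z = exp (CLINT x|lborel. 
      (real n * ts_density a b l a' b' l' x) *\<^sub>R (iexp (z * x / real n) - 1))"
proof -
  let ?f = "ts_density a b l a' b' l'"
  let ?fn = "ts_density (real n powr (1 - b) * a) b (real n * l) (real n powr (1 - b') * a') b' (real n * l')"
  have int: "integrable lborel (\<lambda>x. \<bar>x\<bar> * ?fn x)"
  proof (cases "n = 0")
    case False
    then have "integrable lborel (\<lambda>x. real n * (\<bar>0 + real n * x\<bar> * ?f (0 + real n * x)))"
      by (intro integrable_mult_right lborel_integrable_real_affine ts_density_moments assms) simp
    then show ?thesis
      unfolding ts_density_rescale by (simp add: abs_mult power2_eq_square mult_ac)
  qed (simp add: ts_density_def)
  note char = tempered_stable_char[OF _ _ int]
  show "real_distribution (T n)"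
    unfolding T_def by (rule char) (use assms in auto)
  have "char (T n) z = exp (CLINT x|lborel. ?fn x *\<^sub>R (iexp (z * x) - 1))"
    unfolding T_def by (rule char) (use assms in auto)
  also have "(CLINT x|lborel. ?fn x *\<^sub>R (iexp (z * x) - 1)) =
      (CLINT x|lborel. (real n * ?f x) *\<^sub>R (iexp (z * x / real n) - 1))"
  \<comment> \<open>For n = 0 both integrands are zero because their coefficients are.\<close>
  proof (cases "n = 0")
    case False
    then show ?thesis
      unfolding ts_density_rescale
      by (subst lborel_integral_real_affine[where f = "\<lambda>x. (real n * ?f x) *\<^sub>R (iexp (z * x / real n) - 1)"
            and c = "real n" and t = 0])
         (auto simp: power2_eq_square mult_ac simp flip: integral_scaleR_right
           intro!: Bochner_Integration.integral_cong)
  qed (simp add: ts_density_def)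
  finally show "char (T n) z = exp (CLINT x|lborel.
      (real n * ?f x) *\<^sub>R (iexp (z * x / real n) - 1))" .
qed

section \<open>Passage to the limit\<close>

lemma iexp_difference_quotient_limit:
  "(\<lambda>n. real n *\<^sub>R (iexp (x / real n) - 1)) \<longlonglongrightarrow> \<i> * x"
proof (rule LIM_zero_cancel, rule Lim_null_comparison)
  \<comment> \<open>The Taylor remainder at x / n is of order (x / n)^2 and is multiplied only by
    n.\<close>
  show "eventually (\<lambda>n. norm (real n *\<^sub>R (iexp (x / real n) - 1) - \<i> * x) \<le> x\<^sup>2 / real n) sequentially"
    using eventually_gt_at_top[of 0]
  proof eventually_elim
    case (elim n)
    have "real n *\<^sub>R (iexp (x / real n) - 1) - \<i> * x = real n *\<^sub>R (iexp (x / real n) - 1 - \<i> * (x / real n))"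
      using elim by (simp add: scaleR_conv_of_real right_diff_distrib)
    also have "norm \<dots> = real n * norm (iexp (x / real n) - 1 - \<i> * (x / real n))"
      by simp
    also have "\<dots> \<le> real n * (x\<^sup>2 / (real n)\<^sup>2)"
    proof (rule mult_left_mono)
      have "norm (iexp (x / real n) - 1 - \<i> * (x / real n)) \<le> (x / real n)\<^sup>2 / 2"
        using iexp_approx1[of "x / real n" 1] by (simp add: diff_diff_eq power2_eq_square)
      also have "\<dots> \<le> (x / real n)\<^sup>2" by simp
      finally show "norm (iexp (x / real n) - 1 - \<i> * (x / real n)) \<le> x\<^sup>2 / (real n)\<^sup>2"
        by (simp add: power_divide)
    qed simp
    also have "\<dots> = x\<^sup>2 / real n"
      using elim by (simp add: power2_eq_square)
    finally show ?case .
  qed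
  show "(\<lambda>n. x\<^sup>2 / real n) \<longlonglongrightarrow> 0"
    by (rule lim_const_over_n)
qed

theorem proposition5p1:
  fixes a b l a' b' l' :: real
  assumes "a > 0" and "l > 0" and "a' > 0" and "l' > 0"
    and "0 \<le> b" and "b < 1" and "0 \<le> b'" and "b' < 1"
  shows "weak_conv_m
           (\<lambda>n. tempered_stable
                  (real n powr (1 - b) * a) b (real n * l)
                  (real n powr (1 - b') * a') b' (real n * l'))
           (return borel
             (Gamma (1 - b) * (a / l powr (1 - b)) -
              Gamma (1 - b') * (a' / l' powr (1 - b'))))"
proof -
  let ?f = "ts_density a b l a' b' l'"
  let ?\<mu> = "Gamma (1 - b) * (a / l powr (1 - b)) - Gamma (1 - b') * (a' / l' powr (1 - b'))"
  note ts = tempered_stable_rescale_char[OF \<open>a > 0\<close> \<open>l > 0\<close> \<open>a' > 0\<close> \<open>l' > 0\<close> \<open>b < 1\<close> \<open>b' < 1\<close>]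
  note moments = ts_density_moments[OF \<open>l > 0\<close> \<open>l' > 0\<close> \<open>b < 1\<close> \<open>b' < 1\<close>, of a a']
  have f_nonneg: "?f x \<ge> 0" for x
    using assms by (simp add: ts_density_nonneg)
  have "(\<lambda>n. CLINT x|lborel. (real n * ?f x) *\<^sub>R (iexp (z * x / real n) - 1)) \<longlonglongrightarrow>
      (CLINT x|lborel. \<i> * z * of_real (x * ?f x))" for z
  proof (rule integral_dominated_convergence)
    \<comment> \<open>A majorant free of n: the factor n cancels the 1 / n in |exp (i z x / n) - 1|
      \<le> |z x| / n.\<close>
    show "integrable lborel (\<lambda>x. \<bar>z\<bar> * (\<bar>x\<bar> * ?f x))"
      using moments(1) by simp
    show "AE x in lborel. (\<lambda>n. (real n * ?f x) *\<^sub>R (iexp (z * x / real n) - 1))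
        \<longlonglongrightarrow> \<i> * z * of_real (x * ?f x)"
    proof (rule AE_I2)
      fix x
      have "(\<lambda>n. ?f x *\<^sub>R (real n *\<^sub>R (iexp (z * x / real n) - 1))) \<longlonglongrightarrow> ?f x *\<^sub>R (\<i> * of_real (z * x))"
        by (intro tendsto_scaleR tendsto_const iexp_difference_quotient_limit)
      then show "(\<lambda>n. (real n * ?f x) *\<^sub>R (iexp (z * x / real n) - 1)) \<longlonglongrightarrow> \<i> * z * of_real (x * ?f x)"
        by (simp add: scaleR_conv_of_real mult_ac)
    qed
    fix n
    show "AE x in lborel. norm ((real n * ?f x) *\<^sub>R (iexp (z * x / real n) - 1)) \<le> \<bar>z\<bar> * (\<bar>x\<bar> * ?f x)"
    proof (rule AE_I2)
      fix x
      show "norm ((real n * ?f x) *\<^sub>R (iexp (z * x / real n) - 1)) \<le> \<bar>z\<bar> * (\<bar>x\<bar> * ?f x)"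
      proof (cases "n = 0")
        case False
        have "norm ((real n * ?f x) *\<^sub>R (iexp (z * x / real n) - 1))
            \<le> (real n * ?f x) * \<bar>z * x / real n\<bar>"
          unfolding norm_scaleR using f_nonneg
          by (intro mult_mono cmod_iexp_minus_one_le) auto
        also have "\<dots> = \<bar>z\<bar> * (\<bar>x\<bar> * ?f x)"
          using False by (simp add: abs_mult abs_divide)
        finally show ?thesis .
      qed (simp add: f_nonneg)
    qed
  qed measurable
  \<comment> \<open>The first moment of the Levy density is \<mu>, so the limit exponent is i z
    \<mu>, that of the Dirac measure.\<close>
  moreover have "(CLINT x|lborel. \<i> * z * of_real (x * ?f x)) = \<i> * of_real (z * ?\<mu>)" for z
    using moments(2) by (subst integral_mult_right_zero, subst integral_complex_of_real)
      (simp add: has_bochner_integral_iff)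
  \<comment> \<open>Levy's continuity theorem leaves the pointwise convergence of characteristic
    functions, hence of their exponents.\<close>
  ultimately show ?thesis
    by (intro levy_continuity ts(1) real_distribution_return)
       (unfold ts(2) char_return, intro tendsto_exp, simp only:)
qed

end
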